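(* Let $S$ be an idempotent semifield, let $V$ be a free $S$-module of finite rank $n$ with basis $e_1,\dots,e_n$, and let $w=\sum_{I\in\binom{[n]}{d}}w_Ie_I\in\bigwedge^dV$ be a tropical Plücker vector. Then the tropical linear space $L_w\subset V$ associated to $w$ is the tropical kernel of the wedge-multiplication map $-\wedge w:V\to\bigwedge^{d+1}V$.
   Context: An idempotent semifield $S$ is a (commutative) semiring satisfying all axioms of a field except the existence of additive inverses, and such that $s+s=s$ for all $s\in S$; its additive and multiplicative identities are $0$ and $1$. Write $[n]=\{1,\dots,n\}$, $I+j=I\cup\{j\}$, $I-j=I\smallsetminus\{j\}$, $V^\vee=\mathrm{Hom}_S(V,S)$, and let $x_1,\dots,x_n\in V^\vee$ be the dual basis. The tropical Grassmann algebra of $V$ is $\bigwedge V:=\mathrm{Sym}\,V/\langle e_i^2\sim 0\rangle_{i=1}^n$ (quotient by the generated $S$-algebra congruence), graded by $\bigwedge V=\bigoplus_{d\ge0}\bigwedge^dV$, with commutative product $\wedge$; $\bigwedge^dV$ is free with basis $e_I=e_{i_1}\wedge\cdots\wedge e_{i_d}$, $I\in\binom{[n]}{d}$. A nonzero $w=\sum_I w_Ie_I\in\bigwedge^dV$ is a tropical Plücker vector if for all $A\in\binom{[n]}{d+1}$, $B\in\binom{[n]}{d-1}$ and every $p\in A\smallsetminus B$, $\sum_{i\in A\smallsetminus B}w_{A-i}w_{B+i}=\sum_{i\in A\smallsetminus B,\, i\ne p}w_{A-i}w_{B+i}$. The tropical hyperplane of a linear form $f=\sum_i f_ix_i\in V^\vee$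 is $f^\perp=\{v=\sum_i v_ie_i\in V : \sum_i f_iv_i=\sum_{i\ne j}f_iv_i \text{ for all } j\in[n]\}$. The tropical linear space $L_w\subset V$ associated to a tropical Plücker vector $w$ is the intersection of the tropical hyperplanes of the linear forms $\sum_{i\in J}w_{J-i}x_i$, for all $J\in\binom{[n]}{d+1}$. For a linear map $\varphi:V\to M$ of $S$-modules, the tropical kernel $\mathrm{tropker}(\varphi)\subset V$ is the submodule of all $\sum_iv_ie_i$ such that $\varphi(\sum_iv_ie_i)=\varphi(\sum_{i\ne j}v_ie_i)$ for each $j\in[n]$. *)

theory Defs
  imports "HOL-Library.Poly_Mapping"
begin

section \<open>Idempotent semifields and free modules over them\<close>

class idempotent_semifield = comm_semiring_1 +
  assumes ex_mult_inverse: "a \<noteq> 0 \<Longrightarrow> \<exists>b. a * b = 1"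
    and add_idempotent: "a + a = a"

text \<open>The module is the whole type \<open>'v\<close>. The library locale \<open>module\<close> does not apply, as it
  asks for additive inverses.\<close>

locale semimodule =
  fixes scale :: "'s::comm_semiring_1 \<Rightarrow> 'v::comm_monoid_add \<Rightarrow> 'v"
  assumes scale_right_distrib: "scale a (u + v) = scale a u + scale a v"
    and scale_left_distrib: "scale (a + b) v = scale a v + scale b v"
    and scale_scale: "scale a (scale b v) = scale (a * b) v"
    and scale_one: "scale 1 v = v"
    and scale_zero_left: "scale 0 v = 0"
    and scale_zero_right: "scale a 0 = 0"

text \<open>The basis is \<open>e 1, \<dots>, e n\<close>; the values of \<open>e\<close> outside \<open>{1..n}\<close> are irrelevant.\<close>

locale free_semimodule = semimodule scale
  for scale :: "'s::comm_semiring_1 \<Rightarrow> 'v::comm_monoid_add \<Rightarrow> 'v" +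
  fixes n :: nat and e :: "nat \<Rightarrow> 'v"
  assumes basis: "\<exists>!c. (\<forall>i. i \<notin> {1..n} \<longrightarrow> c i = 0) \<and> v = (\<Sum>i\<in>{1..n}. scale (c i) (e i))"

text \<open>The dual basis: \<open>dual_basis scale n e i\<close> is the linear form \<open>x\<^sub>i\<close>.\<close>

definition dual_basis ::
  "('s::comm_semiring_1 \<Rightarrow> 'v::comm_monoid_add \<Rightarrow> 'v) \<Rightarrow> nat \<Rightarrow> (nat \<Rightarrow> 'v) \<Rightarrow> nat \<Rightarrow> 'v \<Rightarrow> 's" where
  "dual_basis scale n e i v =
    (THE c. (\<forall>i. i \<notin> {1..n} \<longrightarrow> c i = 0) \<and> v = (\<Sum>i\<in>{1..n}. scale (c i) (e i))) i"

section \<open>The tropical Grassmann algebra\<close>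

text \<open>\<open>('v \<Rightarrow>\<^sub>0 nat) \<Rightarrow>\<^sub>0 's\<close> is the free commutative \<open>'s\<close>-algebra on the underlying set of the
  module, i.e. the polynomials over \<open>'s\<close> in one variable for each \<open>v :: 'v\<close>.\<close>

definition gen :: "'v \<Rightarrow> ('v \<Rightarrow>\<^sub>0 nat) \<Rightarrow>\<^sub>0 's::comm_semiring_1" where
  "gen v = Poly_Mapping.single (Poly_Mapping.single v 1) 1"

definition const :: "'s \<Rightarrow> ('v \<Rightarrow>\<^sub>0 nat) \<Rightarrow>\<^sub>0 's::comm_semiring_1" where
  "const a = Poly_Mapping.single 0 a"

definition homogeneous :: "nat \<Rightarrow> (('v \<Rightarrow>\<^sub>0 nat) \<Rightarrow>\<^sub>0 's::comm_semiring_1) \<Rightarrow> bool" where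
  "homogeneous d p \<longleftrightarrow>
    (\<forall>m\<in>Poly_Mapping.keys p. (\<Sum>v\<in>Poly_Mapping.keys m. Poly_Mapping.lookup m v) = d)"

text \<open>The congruence generated by a relation. Compatibility with scalars is the case of
  \<open>mult\<close> in which one factor is a constant.\<close>

inductive generated_congruence ::
  "('a::comm_semiring_1 \<Rightarrow> 'a \<Rightarrow> bool) \<Rightarrow> 'a \<Rightarrow> 'a \<Rightarrow> bool" for R where
  base: "R p q \<Longrightarrow> generated_congruence R p q"
| refl: "generated_congruence R p p"
| sym: "generated_congruence R p q \<Longrightarrow> generated_congruence R q p"
| trans: "generated_congruence R p q \<Longrightarrow> generated_congruence R q r \<Longrightarrow> generated_congruence R p r"
| add: "generated_congruence R p q \<Longrightarrow> generated_congruence R p' q'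
    \<Longrightarrow> generated_congruence R (p + p') (q + q')"
| mult: "generated_congruence R p q \<Longrightarrow> generated_congruence R p' q'
    \<Longrightarrow> generated_congruence R (p * p') (q * q')"

text \<open>\<open>linear_add\<close> and \<open>linear_scale\<close> present the symmetric algebra of the module (they make
  \<open>gen\<close> linear); \<open>square\<close> is the additional relation of the Grassmann algebra. The two
  quotients are taken in one step.\<close>

inductive grassmann_relation ::
  "('s::comm_semiring_1 \<Rightarrow> 'v::comm_monoid_add \<Rightarrow> 'v) \<Rightarrow> nat \<Rightarrow> (nat \<Rightarrow> 'v)
    \<Rightarrow> (('v \<Rightarrow>\<^sub>0 nat) \<Rightarrow>\<^sub>0 's) \<Rightarrow> (('v \<Rightarrow>\<^sub>0 nat) \<Rightarrow>\<^sub>0 's) \<Rightarrow> bool" for scale n e where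
  linear_add: "grassmann_relation scale n e (gen (u + v)) (gen u + gen v)"
| linear_scale: "grassmann_relation scale n e (gen (scale a v)) (const a * gen v)"
| square: "i \<in> {1..n} \<Longrightarrow> grassmann_relation scale n e (gen (e i) ^ 2) 0"

definition grassmann_congruence ::
  "('s::comm_semiring_1 \<Rightarrow> 'v::comm_monoid_add \<Rightarrow> 'v) \<Rightarrow> nat \<Rightarrow> (nat \<Rightarrow> 'v)
    \<Rightarrow> (('v \<Rightarrow>\<^sub>0 nat) \<Rightarrow>\<^sub>0 's) rel" where
  "grassmann_congruence scale n e =
    {(p, q). generated_congruence (grassmann_relation scale n e) p q}"

text \<open>Elements of the Grassmann algebra are congruence classes of polynomials.\<close>

definition grassmann_class ::
  "('s::comm_semiring_1 \<Rightarrow> 'v::comm_monoid_add \<Rightarrow> 'v) \<Rightarrow> nat \<Rightarrow> (nat \<Rightarrow> 'v)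
    \<Rightarrow> (('v \<Rightarrow>\<^sub>0 nat) \<Rightarrow>\<^sub>0 's) \<Rightarrow> (('v \<Rightarrow>\<^sub>0 nat) \<Rightarrow>\<^sub>0 's) set" where
  "grassmann_class scale n e p = grassmann_congruence scale n e `` {p}"

definition grassmann_algebra ::
  "('s::comm_semiring_1 \<Rightarrow> 'v::comm_monoid_add \<Rightarrow> 'v) \<Rightarrow> nat \<Rightarrow> (nat \<Rightarrow> 'v)
    \<Rightarrow> (('v \<Rightarrow>\<^sub>0 nat) \<Rightarrow>\<^sub>0 's) set set" where
  "grassmann_algebra scale n e = UNIV // grassmann_congruence scale n e"

definition grassmann_degree ::
  "('s::comm_semiring_1 \<Rightarrow> 'v::comm_monoid_add \<Rightarrow> 'v) \<Rightarrow> nat \<Rightarrow> (nat \<Rightarrow> 'v) \<Rightarrow> nat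
    \<Rightarrow> (('v \<Rightarrow>\<^sub>0 nat) \<Rightarrow>\<^sub>0 's) set set" where
  "grassmann_degree scale n e d =
    {W \<in> grassmann_algebra scale n e. \<exists>p\<in>W. homogeneous d p}"

text \<open>The product of two classes, given as usual by the class of \<open>p * q\<close> for any
  representatives \<open>p\<close> and \<open>q\<close>.\<close>

definition wedge ::
  "('s::comm_semiring_1 \<Rightarrow> 'v::comm_monoid_add \<Rightarrow> 'v) \<Rightarrow> nat \<Rightarrow> (nat \<Rightarrow> 'v)
    \<Rightarrow> (('v \<Rightarrow>\<^sub>0 nat) \<Rightarrow>\<^sub>0 's) set \<Rightarrow> (('v \<Rightarrow>\<^sub>0 nat) \<Rightarrow>\<^sub>0 's) set \<Rightarrow> (('v \<Rightarrow>\<^sub>0 nat) \<Rightarrow>\<^sub>0 's) set" where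
  "wedge scale n e P Q = (\<Union>p\<in>P. \<Union>q\<in>Q. grassmann_class scale n e (p * q))"

text \<open>The combination of the basis elements \<open>e\<^sub>I\<close>, for \<open>I\<close> ranging over the \<open>d\<close>-subsets of
  \<open>{1..n}\<close>, with coefficients \<open>c I\<close>; the sum is formed on representatives.\<close>

definition grassmann_combination ::
  "('s::comm_semiring_1 \<Rightarrow> 'v::comm_monoid_add \<Rightarrow> 'v) \<Rightarrow> nat \<Rightarrow> (nat \<Rightarrow> 'v) \<Rightarrow> nat
    \<Rightarrow> (nat set \<Rightarrow> 's) \<Rightarrow> (('v \<Rightarrow>\<^sub>0 nat) \<Rightarrow>\<^sub>0 's) set" where
  "grassmann_combination scale n e d c =
    grassmann_class scale n e (\<Sum>I | I \<subseteq> {1..n} \<and> card I = d. const (c I) * (\<Prod>i\<in>I. gen (e i)))"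

text \<open>The coefficient of \<open>e\<^sub>I\<close> in an element of degree \<open>d\<close>. It is well defined because the
  \<open>e\<^sub>I\<close> form a basis of the degree \<open>d\<close> part.\<close>

definition grassmann_coeff ::
  "('s::comm_semiring_1 \<Rightarrow> 'v::comm_monoid_add \<Rightarrow> 'v) \<Rightarrow> nat \<Rightarrow> (nat \<Rightarrow> 'v) \<Rightarrow> nat
    \<Rightarrow> (('v \<Rightarrow>\<^sub>0 nat) \<Rightarrow>\<^sub>0 's) set \<Rightarrow> nat set \<Rightarrow> 's" where
  "grassmann_coeff scale n e d W I =
    (THE c. (\<forall>I. \<not> (I \<subseteq> {1..n} \<and> card I = d) \<longrightarrow> c I = 0)
      \<and> W = grassmann_combination scale n e d c) I"

section \<open>Tropical linear algebra\<close>

text \<open>The condition on \<open>B\<close> is written \<open>card B + 1 = d\<close>, so that no \<open>B\<close> occurs when \<open>d = 0\<close>.\<close>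

definition tropical_pluecker_vector ::
  "('s::comm_semiring_1 \<Rightarrow> 'v::comm_monoid_add \<Rightarrow> 'v) \<Rightarrow> nat \<Rightarrow> (nat \<Rightarrow> 'v) \<Rightarrow> nat
    \<Rightarrow> (('v \<Rightarrow>\<^sub>0 nat) \<Rightarrow>\<^sub>0 's) set \<Rightarrow> bool" where
  "tropical_pluecker_vector scale n e d W \<longleftrightarrow>
    W \<in> grassmann_degree scale n e d \<and> W \<noteq> grassmann_class scale n e 0 \<and>
    (let w = grassmann_coeff scale n e d W in
      \<forall>A B. A \<subseteq> {1..n} \<and> card A = d + 1 \<and> B \<subseteq> {1..n} \<and> card B + 1 = d \<longrightarrow>
        (\<forall>p \<in> A - B. (\<Sum>i\<in>A - B. w (A - {i}) * w (B \<union> {i})) =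
                     (\<Sum>i\<in>A - B - {p}. w (A - {i}) * w (B \<union> {i}))))"

text \<open>The coefficient of \<open>x\<^sub>i\<close> in a linear form \<open>f\<close> is \<open>f (e i)\<close>.\<close>

definition tropical_hyperplane ::
  "('s::comm_semiring_1 \<Rightarrow> 'v::comm_monoid_add \<Rightarrow> 'v) \<Rightarrow> nat \<Rightarrow> (nat \<Rightarrow> 'v) \<Rightarrow> ('v \<Rightarrow> 's) \<Rightarrow> 'v set" where
  "tropical_hyperplane scale n e f =
    {v. \<forall>j\<in>{1..n}. (\<Sum>i\<in>{1..n}. f (e i) * dual_basis scale n e i v) =
                   (\<Sum>i\<in>{1..n} - {j}. f (e i) * dual_basis scale n e i v)}"

definition tropical_linear_space ::
  "('s::comm_semiring_1 \<Rightarrow> 'v::comm_monoid_add \<Rightarrow> 'v) \<Rightarrow> nat \<Rightarrow> (nat \<Rightarrow> 'v) \<Rightarrow> nat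
    \<Rightarrow> (('v \<Rightarrow>\<^sub>0 nat) \<Rightarrow>\<^sub>0 's) set \<Rightarrow> 'v set" where
  "tropical_linear_space scale n e d W =
    (\<Inter>J\<in>{J. J \<subseteq> {1..n} \<and> card J = d + 1}. tropical_hyperplane scale n e
      (\<lambda>v. \<Sum>i\<in>J. grassmann_coeff scale n e d W (J - {i}) * dual_basis scale n e i v))"

definition tropical_kernel ::
  "('s::comm_semiring_1 \<Rightarrow> 'v::comm_monoid_add \<Rightarrow> 'v) \<Rightarrow> nat \<Rightarrow> (nat \<Rightarrow> 'v) \<Rightarrow> ('v \<Rightarrow> 'm) \<Rightarrow> 'v set" where
  "tropical_kernel scale n e \<phi> =
    {v. \<forall>j\<in>{1..n}. \<phi> (\<Sum>i\<in>{1..n}. scale (dual_basis scale n e i v) (e i)) =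
                   \<phi> (\<Sum>i\<in>{1..n} - {j}. scale (dual_basis scale n e i v) (e i))}"

definition wedge_map ::
  "('s::comm_semiring_1 \<Rightarrow> 'v::comm_monoid_add \<Rightarrow> 'v) \<Rightarrow> nat \<Rightarrow> (nat \<Rightarrow> 'v)
    \<Rightarrow> (('v \<Rightarrow>\<^sub>0 nat) \<Rightarrow>\<^sub>0 's) set \<Rightarrow> 'v \<Rightarrow> (('v \<Rightarrow>\<^sub>0 nat) \<Rightarrow>\<^sub>0 's) set" where
  "wedge_map scale n e W v = wedge scale n e (grassmann_class scale n e (gen v)) W"

end

theory Submission
  imports Defs
begin

text \<open>
  Write \<open>w\<close> as the combination of the \<open>e\<^sub>I\<close> with coefficients \<open>w\<^sub>I\<close>. Expanding the product with
  \<open>v = \<Sum>\<^sub>i v\<^sub>i e\<^sub>i\<close> and dropping the terms with \<open>e\<^sub>i\<^sup>2\<close> shows that the coefficient of \<open>e\<^sub>J\<close> in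
  \<open>v \<and> w\<close> is \<open>\<Sum>\<^sub>i\<^sub>\<in>\<^sub>J w\<^bsub>J-i\<^esub> v\<^sub>i\<close>, that is, the linear form belonging to \<open>J\<close> in the definition of
  the tropical linear space, evaluated at \<open>v\<close>. Deleting the \<open>j\<close>-th coordinate of \<open>v\<close> deletes the
  \<open>j\<close>-th summand of each of these sums. Since the \<open>e\<^sub>J\<close> are linearly independent, \<open>v\<close> lies in the
  tropical kernel of the multiplication by \<open>w\<close> if and only if, for every \<open>J\<close>, it lies in the
  tropical hyperplane of the form belonging to \<open>J\<close>.

  What needs work is that the \<open>e\<^sub>I\<close> with \<open>card I = d\<close> form a basis of the degree \<open>d\<close> part of the
  Grassmann algebra, which is defined as the quotient of the polynomial semiring with one variable
  for each vector by a generated congruence. They span because of the product formula \<open>congruent_gen_mult_combination\<close> itself: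
  it says that multiplying a combination of the \<open>e\<^sub>I\<close> by a vector gives again such a combination,
  so all monomials are reached by induction (\<open>homogeneous_congruent_combination\<close>). They are
  independent because their coefficients can be read off after a substitution
  (\<open>combination_coeffs_unique\<close>): replacing every vector by its linear form in indeterminates
  \<open>X\<^sub>1, \<dots>, X\<^sub>n\<close> is a homomorphism to an ordinary polynomial semiring, and it carries congruent
  elements to polynomials that agree on all squarefree monomials.
\<close>

section \<open>Substitution in polynomials\<close>

\<comment> \<open>so that \<open>{1..n}\<close> keeps the same form throughout\<close>
declare One_nat_def [simp del]

lemma const_0 [simp]: "const 0 = 0"
  and const_1 [simp]: "const 1 = 1"
  and const_add: "const (a + b) = const a + const b"
  and const_mult: "const (a * b) = const a * const b"
  by (simp_all add: const_def single_add mult_single)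

lemma const_sum: "const (\<Sum>i\<in>A. f i) = (\<Sum>i\<in>A. const (f i))"
  by (induction A rule: infinite_finite_induct) (simp_all add: const_add)

lemma const_mult_single: "const a * Poly_Mapping.single m b = Poly_Mapping.single m (a * b)"
  by (simp add: const_def mult_single)

lemma poly_mapping_eq_sum_single:
  "p = (\<Sum>k\<in>Poly_Mapping.keys p. Poly_Mapping.single k (Poly_Mapping.lookup p k))"
proof (rule poly_mapping_eqI)
  fix k
  show "Poly_Mapping.lookup p k =
      Poly_Mapping.lookup (\<Sum>k\<in>Poly_Mapping.keys p. Poly_Mapping.single k (Poly_Mapping.lookup p k)) k"
    by (auto simp: lookup_sum lookup_single when_def in_keys_iff)
qed

lemma single_power:
  "Poly_Mapping.single (Poly_Mapping.single v 1) (1::'s::comm_semiring_1) ^ k =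
    Poly_Mapping.single (Poly_Mapping.single v k) 1"
  by (induction k) (simp_all add: mult_single plus_1_eq_Suc flip: single_add)

lemma prod_single:
  "(\<Prod>i\<in>A. Poly_Mapping.single (f i) (1::'s::comm_semiring_1)) = Poly_Mapping.single (\<Sum>i\<in>A. f i) 1"
  by (induction A rule: infinite_finite_induct) (simp_all add: mult_single)

lemma monomial_eq_prod_gen:
  "Poly_Mapping.single m (1::'s::comm_semiring_1) =
    (\<Prod>v\<in>Poly_Mapping.keys m. gen v ^ Poly_Mapping.lookup m v)"
  using poly_mapping_eq_sum_single [of m]
  by (simp add: gen_def single_power prod_single del: One_nat_def)

definition monomial_value :: "('v \<Rightarrow> 'a::comm_semiring_1) \<Rightarrow> ('v \<Rightarrow>\<^sub>0 nat) \<Rightarrow> 'a" where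
  "monomial_value g m = (\<Prod>v\<in>Poly_Mapping.keys m. g v ^ Poly_Mapping.lookup m v)"

lemma monomial_value_superset:
  assumes "finite K" "Poly_Mapping.keys m \<subseteq> K"
  shows "monomial_value g m = (\<Prod>v\<in>K. g v ^ Poly_Mapping.lookup m v)"
  unfolding monomial_value_def
  by (rule prod.mono_neutral_left) (use assms in \<open>auto simp: in_keys_iff\<close>)

lemma monomial_value_add: "monomial_value g (m + m') = monomial_value g m * monomial_value g m'"
proof -
  let ?K = "Poly_Mapping.keys m \<union> Poly_Mapping.keys m'"
  have "monomial_value g (m + m') = (\<Prod>v\<in>?K. g v ^ Poly_Mapping.lookup (m + m') v)"
    by (rule monomial_value_superset) (auto simp: keys_add)
  also have "\<dots> = (\<Prod>v\<in>?K. g v ^ Poly_Mapping.lookup m v) * (\<Prod>v\<in>?K. g v ^ Poly_Mapping.lookup m' v)"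
    by (simp add: lookup_add power_add prod.distrib)
  also have "\<dots> = monomial_value g m * monomial_value g m'"
    by (simp add: monomial_value_superset [of ?K])
  finally show ?thesis .
qed

definition substitute ::
  "('v \<Rightarrow> ('w \<Rightarrow>\<^sub>0 nat) \<Rightarrow>\<^sub>0 's) \<Rightarrow> (('v \<Rightarrow>\<^sub>0 nat) \<Rightarrow>\<^sub>0 's::comm_semiring_1) \<Rightarrow> ('w \<Rightarrow>\<^sub>0 nat) \<Rightarrow>\<^sub>0 's" where
  "substitute g p =
    (\<Sum>m\<in>Poly_Mapping.keys p. const (Poly_Mapping.lookup p m) * monomial_value g m)"

lemma substitute_superset:
  assumes "finite K" "Poly_Mapping.keys p \<subseteq> K"
  shows "substitute g p = (\<Sum>m\<in>K. const (Poly_Mapping.lookup p m) * monomial_value g m)"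
  unfolding substitute_def
  by (rule sum.mono_neutral_left) (use assms in \<open>auto simp: in_keys_iff\<close>)

lemma substitute_add: "substitute g (p + q) = substitute g p + substitute g q"
proof -
  let ?K = "Poly_Mapping.keys p \<union> Poly_Mapping.keys q"
  have "substitute g (p + q) =
      (\<Sum>m\<in>?K. const (Poly_Mapping.lookup (p + q) m) * monomial_value g m)"
    by (rule substitute_superset) (auto simp: keys_add)
  also have "\<dots> = (\<Sum>m\<in>?K. const (Poly_Mapping.lookup p m) * monomial_value g m)
      + (\<Sum>m\<in>?K. const (Poly_Mapping.lookup q m) * monomial_value g m)"
    by (simp add: lookup_add const_add distrib_right sum.distrib)
  also have "\<dots> = substitute g p + substitute g q"
    by (simp add: substitute_superset [of ?K])
  finally show ?thesis .
qed

lemma substitute_0 [simp]: "substitute g 0 = 0"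
  by (simp add: substitute_def)

lemma substitute_sum: "substitute g (\<Sum>i\<in>A. f i) = (\<Sum>i\<in>A. substitute g (f i))"
  by (induction A rule: infinite_finite_induct) (simp_all add: substitute_add)

lemma substitute_single: "substitute g (Poly_Mapping.single m a) = const a * monomial_value g m"
  by (cases "a = 0") (simp_all add: substitute_def)

lemma substitute_const [simp]: "substitute g (const a) = const a"
  by (subst const_def) (simp add: substitute_single monomial_value_def)

lemma substitute_gen [simp]: "substitute g (gen v) = g v"
  by (simp add: gen_def substitute_single monomial_value_def)

lemma substitute_mult: "substitute g (p * q) = substitute g p * substitute g q"
proof -
  let ?s = "\<lambda>p m. Poly_Mapping.single m (Poly_Mapping.lookup p m)"
  have "p * q = (\<Sum>m\<in>Poly_Mapping.keys p. \<Sum>m'\<in>Poly_Mapping.keys q. ?s p m * ?s q m')"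
    unfolding sum_product [symmetric] using poly_mapping_eq_sum_single [of p] poly_mapping_eq_sum_single [of q]
    by simp
  then have "substitute g (p * q) =
      (\<Sum>m\<in>Poly_Mapping.keys p. \<Sum>m'\<in>Poly_Mapping.keys q. substitute g (?s p m * ?s q m'))"
    by (simp add: substitute_sum)
  also have "\<dots> = substitute g p * substitute g q"
    unfolding substitute_def [of g p] substitute_def [of g q] sum_product
    by (simp add: mult_single substitute_single monomial_value_add const_mult ac_simps)
  finally show ?thesis .
qed

lemma substitute_prod: "substitute g (\<Prod>i\<in>A. f i) = (\<Prod>i\<in>A. substitute g (f i))"
proof (induction A rule: infinite_finite_induct)
  have "substitute g 1 = 1"
    using substitute_const [of g 1] by simp
  then show "substitute g (\<Prod>i\<in>A. f i) = (\<Prod>i\<in>A. substitute g (f i))" if "infinite A" for A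
    using that by simp
  show "substitute g (\<Prod>i\<in>{}. f i) = (\<Prod>i\<in>{}. substitute g (f i))"
    using \<open>substitute g 1 = 1\<close> by simp
qed (simp add: substitute_mult)

section \<open>Polynomials agreeing on squarefree monomials\<close>

definition squarefree_monomial :: "('w \<Rightarrow>\<^sub>0 nat) \<Rightarrow> bool" where
  "squarefree_monomial m \<longleftrightarrow> (\<forall>i. Poly_Mapping.lookup m i \<le> 1)"

definition agree_squarefree ::
  "(('w \<Rightarrow>\<^sub>0 nat) \<Rightarrow>\<^sub>0 's::comm_semiring_1) \<Rightarrow> (('w \<Rightarrow>\<^sub>0 nat) \<Rightarrow>\<^sub>0 's) \<Rightarrow> bool" where
  "agree_squarefree p q \<longleftrightarrow>
    (\<forall>m. squarefree_monomial m \<longrightarrow> Poly_Mapping.lookup p m = Poly_Mapping.lookup q m)"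

text \<open>A coefficient of a product at a squarefree monomial involves only coefficients of the factors
  at its divisors, and these are squarefree too.\<close>

lemma agree_squarefree_mult:
  assumes "agree_squarefree p q" "agree_squarefree p' q'"
  shows "agree_squarefree (p * p') (q * q')"
  unfolding agree_squarefree_def
proof (intro allI impI)
  fix m :: "'a \<Rightarrow>\<^sub>0 nat"
  assume m: "squarefree_monomial m"
  have divisors: "squarefree_monomial l \<and> squarefree_monomial k" if "m = l + k" for l k
    unfolding squarefree_monomial_def
  proof (intro conjI allI)
    fix i
    have "Poly_Mapping.lookup l i + Poly_Mapping.lookup k i \<le> 1"
      using m that by (simp add: squarefree_monomial_def lookup_add)
    then show "Poly_Mapping.lookup l i \<le> 1" "Poly_Mapping.lookup k i \<le> 1"
      by simp_all
  qed
  have inner: "(\<Sum>k. Poly_Mapping.lookup p' k when m = l + k) =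
      (\<Sum>k. Poly_Mapping.lookup q' k when m = l + k)" for l
    using assms(2) divisors by (intro Sum_any.cong) (auto simp: when_def agree_squarefree_def)
  have "Poly_Mapping.lookup p l * (\<Sum>k. Poly_Mapping.lookup q' k when m = l + k) =
      Poly_Mapping.lookup q l * (\<Sum>k. Poly_Mapping.lookup q' k when m = l + k)" for l
  proof (cases "\<exists>k. m = l + k")
    case True
    then have "Poly_Mapping.lookup p l = Poly_Mapping.lookup q l"
      using assms(1) divisors by (auto simp: agree_squarefree_def)
    then show ?thesis
      by simp
  qed simp
  then show "Poly_Mapping.lookup (p * p') m = Poly_Mapping.lookup (q * q') m"
    by (simp add: lookup_mult inner)
qed

section \<open>Coordinates\<close>

context free_semimodule
begin

lemma coordinates: "(\<forall>i. i \<notin> {1..n} \<longrightarrow> dual_basis scale n e i v = 0) \<and>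
    v = (\<Sum>i\<in>{1..n}. scale (dual_basis scale n e i v) (e i))"
  unfolding dual_basis_def by (rule theI' [OF basis])

lemma dual_basis_eqI:
  assumes "\<And>i. i \<notin> {1..n} \<Longrightarrow> c i = 0" "v = (\<Sum>i\<in>{1..n}. scale (c i) (e i))"
  shows "dual_basis scale n e i v = c i"
  unfolding dual_basis_def using assms by (subst the1_equality [OF basis]) auto

lemma dual_basis_add:
  "dual_basis scale n e i (u + v) = dual_basis scale n e i u + dual_basis scale n e i v"
proof (rule dual_basis_eqI)
  have "u + v = (\<Sum>i\<in>{1..n}. scale (dual_basis scale n e i u) (e i)) +
      (\<Sum>i\<in>{1..n}. scale (dual_basis scale n e i v) (e i))"
    using coordinates by metis
  then show "u + v =
      (\<Sum>i\<in>{1..n}. scale (dual_basis scale n e i u + dual_basis scale n e i v) (e i))"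
    by (simp add: scale_left_distrib sum.distrib)
qed (use coordinates in auto)

lemma scale_sum: "scale a (\<Sum>i\<in>A. f i) = (\<Sum>i\<in>A. scale a (f i))"
  by (induction A rule: infinite_finite_induct) (simp_all add: scale_zero_right scale_right_distrib)

lemma dual_basis_scale: "dual_basis scale n e i (scale a v) = a * dual_basis scale n e i v"
proof (rule dual_basis_eqI)
  have "scale a v = scale a (\<Sum>i\<in>{1..n}. scale (dual_basis scale n e i v) (e i))"
    using coordinates by metis
  then show "scale a v = (\<Sum>i\<in>{1..n}. scale (a * dual_basis scale n e i v) (e i))"
    by (simp add: scale_sum scale_scale)
qed (use coordinates in auto)

lemma dual_basis_partial_sum:
  assumes "K \<subseteq> {1..n}"
  shows "dual_basis scale n e i (\<Sum>k\<in>K. scale (a k) (e k)) = (if i \<in> K then a i else 0)"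
proof (rule dual_basis_eqI)
  show "(\<Sum>k\<in>K. scale (a k) (e k)) = (\<Sum>k\<in>{1..n}. scale (if k \<in> K then a k else 0) (e k))"
    by (rule sum.mono_neutral_cong_left) (use assms in \<open>auto simp: scale_zero_left\<close>)
qed (use assms in auto)

lemma dual_basis_basis:
  assumes "k \<in> {1..n}"
  shows "dual_basis scale n e i (e k) = (if i = k then 1 else 0)"
  using dual_basis_partial_sum [of "{k}" i "\<lambda>_. 1"] assms by (simp add: scale_one)

section \<open>Calculation modulo the Grassmann congruence\<close>

abbreviation congruent (infix "\<approx>" 50) where
  "p \<approx> q \<equiv> generated_congruence (grassmann_relation scale n e) p q"

abbreviation combination :: "nat \<Rightarrow> (nat set \<Rightarrow> 's) \<Rightarrow> ('v \<Rightarrow>\<^sub>0 nat) \<Rightarrow>\<^sub>0 's" where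
  "combination d c \<equiv> (\<Sum>I | I \<subseteq> {1..n} \<and> card I = d. const (c I) * (\<Prod>i\<in>I. gen (e i)))"

lemma finite_index_sets [simp]: "finite {I. I \<subseteq> {1..n} \<and> card I = d}"
  by (rule finite_subset [of _ "Pow {1..n}"]) auto

lemma finite_index_set:
  assumes "I \<subseteq> {1..n}"
  shows "finite I"
  using assms by (rule finite_subset) simp

lemma congruent_relation: "grassmann_relation scale n e p q \<Longrightarrow> p \<approx> q"
  by (rule generated_congruence.base)

lemma congruent_sum:
  assumes "\<And>i. i \<in> A \<Longrightarrow> f i \<approx> g i"
  shows "(\<Sum>i\<in>A. f i) \<approx> (\<Sum>i\<in>A. g i)"
  using assms
  by (induction A rule: infinite_finite_induct)
    (simp_all add: generated_congruence.refl generated_congruence.add)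

lemma class_eq_iff: "grassmann_class scale n e p = grassmann_class scale n e q \<longleftrightarrow> p \<approx> q"
proof
  assume "grassmann_class scale n e p = grassmann_class scale n e q"
  moreover have "q \<in> grassmann_class scale n e q"
    by (simp add: grassmann_class_def grassmann_congruence_def generated_congruence.refl)
  ultimately show "p \<approx> q"
    by (auto simp: grassmann_class_def grassmann_congruence_def)
next
  assume "p \<approx> q"
  then show "grassmann_class scale n e p = grassmann_class scale n e q"
    by (auto simp: grassmann_class_def grassmann_congruence_def
        intro: generated_congruence.sym generated_congruence.trans)
qed

lemma mem_class_iff: "p \<in> grassmann_class scale n e q \<longleftrightarrow> q \<approx> p"
  by (simp add: grassmann_class_def grassmann_congruence_def)

lemma wedge_class:
  "wedge scale n e (grassmann_class scale n e p) (grassmann_class scale n e q) =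
    grassmann_class scale n e (p * q)"
proof -
  have "grassmann_class scale n e (p' * q') = grassmann_class scale n e (p * q)"
    if "p' \<in> grassmann_class scale n e p" "q' \<in> grassmann_class scale n e q" for p' q'
    using that
    by (auto simp: class_eq_iff mem_class_iff intro: generated_congruence.sym generated_congruence.mult)
  moreover have "p \<in> grassmann_class scale n e p" "q \<in> grassmann_class scale n e q"
    by (simp_all add: mem_class_iff generated_congruence.refl)
  ultimately show ?thesis
    unfolding wedge_def by blast
qed

lemma congruent_gen_linear:
  "gen (\<Sum>i\<in>A. scale (a i) (u i)) \<approx> (\<Sum>i\<in>A. const (a i) * gen (u i))"
proof (induction A rule: infinite_finite_induct)
  \<comment> \<open>The zero vector is \<open>scale 0 0\<close>, so its generator is congruent to a multiple of \<open>const 0\<close>.\<close>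
  have gen_zero: "gen (0::'v) \<approx> 0"
    using congruent_relation [OF grassmann_relation.linear_scale [of scale n e 0 0]]
    by (simp add: scale_zero_right)
  {
    case (infinite A)
    then show ?case
      using gen_zero by simp
  next
    case empty
    then show ?case
      using gen_zero by simp
  next
    case (insert k A)
    have "gen (scale (a k) (u k) + (\<Sum>i\<in>A. scale (a i) (u i))) \<approx>
        gen (scale (a k) (u k)) + gen (\<Sum>i\<in>A. scale (a i) (u i))"
      by (rule congruent_relation [OF grassmann_relation.linear_add])
    moreover have "\<dots> \<approx> const (a k) * gen (u k) + (\<Sum>i\<in>A. const (a i) * gen (u i))"
      by (intro generated_congruence.add insert.IH
          congruent_relation [OF grassmann_relation.linear_scale])
    ultimately show ?case
      using insert.hyps by (auto intro: generated_congruence.trans)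
  }
qed

lemma congruent_gen_mult_basis:
  assumes "i \<in> {1..n}" "I \<subseteq> {1..n}"
  shows "gen (e i) * (\<Prod>k\<in>I. gen (e k)) \<approx> (if i \<in> I then 0 else (\<Prod>k\<in>insert i I. gen (e k)))"
proof -
  have "finite I"
    using assms(2) finite_subset by blast
  show ?thesis
  proof (cases "i \<in> I")
    case True
    then have "gen (e i) * (\<Prod>k\<in>I. gen (e k)) =
        (gen (e i) ^ 2 * (\<Prod>k\<in>I - {i}. gen (e k)) :: ('v \<Rightarrow>\<^sub>0 nat) \<Rightarrow>\<^sub>0 's)"
      using \<open>finite I\<close> by (simp add: prod.remove power2_eq_square mult.assoc)
    moreover have "\<dots> \<approx> 0 * (\<Prod>k\<in>I - {i}. gen (e k))"
      by (intro generated_congruence.mult generated_congruence.refl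
          congruent_relation [OF grassmann_relation.square] assms(1))
    ultimately show ?thesis
      using True by simp
  next
    case False
    then show ?thesis
      using \<open>finite I\<close> by (simp add: generated_congruence.refl)
  qed
qed

text \<open>The product formula: after expanding, the terms in which \<open>i\<close> occurs in \<open>I\<close> vanish, and the
  other pairs \<open>(i, I)\<close> correspond to the pairs \<open>(J, i)\<close> with \<open>i \<in> J\<close>, by \<open>J = I + i\<close>.\<close>

lemma congruent_gen_mult_combination:
  "gen v * combination d c \<approx>
    combination (d + 1) (\<lambda>J. \<Sum>i\<in>J. dual_basis scale n e i v * c (J - {i}))"
proof -
  let ?x = "\<lambda>i. dual_basis scale n e i v"
  let ?E = "\<lambda>I. \<Prod>i\<in>I. gen (e i) :: ('v \<Rightarrow>\<^sub>0 nat) \<Rightarrow>\<^sub>0 's"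
  let ?N = "{1..n}"
  let ?D = "\<lambda>d. {I. I \<subseteq> {1..n} \<and> card I = d}"
  have "gen v \<approx> (\<Sum>i\<in>?N. const (?x i) * gen (e i))"
    using congruent_gen_linear [of ?x e ?N] coordinates [of v] by simp
  then have "gen v * combination d c \<approx> (\<Sum>i\<in>?N. const (?x i) * gen (e i)) * combination d c"
    by (intro generated_congruence.mult generated_congruence.refl)
  also have "(\<Sum>i\<in>?N. const (?x i) * gen (e i)) * combination d c =
      (\<Sum>i\<in>?N. \<Sum>I\<in>?D d. const (?x i * c I) * (gen (e i) * ?E I))"
    unfolding sum_product by (simp add: const_mult ac_simps)
  finally have expand: "gen v * combination d c \<approx>
      (\<Sum>i\<in>?N. \<Sum>I\<in>?D d. const (?x i * c I) * (gen (e i) * ?E I))" .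
  have vanish: "(\<Sum>i\<in>?N. \<Sum>I\<in>?D d. const (?x i * c I) * (gen (e i) * ?E I)) \<approx>
      (\<Sum>i\<in>?N. \<Sum>I\<in>?D d. const (?x i * c I) * (if i \<in> I then 0 else ?E (insert i I)))"
    by (intro congruent_sum generated_congruence.mult generated_congruence.refl
        congruent_gen_mult_basis) auto
  have "(\<Sum>i\<in>?N. \<Sum>I\<in>?D d. const (?x i * c I) * (if i \<in> I then 0 else ?E (insert i I))) =
      (\<Sum>(i, I)\<in>?N \<times> ?D d. const (?x i * c I) * (if i \<in> I then 0 else ?E (insert i I)))"
    by (simp add: sum.cartesian_product)
  also have "\<dots> = (\<Sum>(i, I)\<in>{(i, I) \<in> ?N \<times> ?D d. i \<notin> I}. const (?x i * c I) * ?E (insert i I))"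
    by (rule sum.mono_neutral_cong_right) (auto split: if_splits)
  also have "\<dots> = (\<Sum>(J, i)\<in>(SIGMA J:?D (d + 1). J). const (?x i * c (J - {i})) * ?E J)"
    by (rule sum.reindex_bij_witness
        [where i = "\<lambda>(J, i). (i, J - {i})" and j = "\<lambda>(i, I). (insert i I, i)"])
      (auto simp: finite_index_set insert_absorb card_Diff_singleton_if)
  also have "\<dots> = (\<Sum>J\<in>?D (d + 1). \<Sum>i\<in>J. const (?x i * c (J - {i})) * ?E J)"
    by (subst sum.Sigma) (auto intro: finite_index_set)
  also have "\<dots> = combination (d + 1) (\<lambda>J. \<Sum>i\<in>J. ?x i * c (J - {i}))"
    by (simp add: const_sum sum_distrib_right)
  finally show ?thesis
    using expand vanish by (metis (no_types, lifting) generated_congruence.trans)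
qed

section \<open>The basis of the homogeneous parts\<close>

definition congruent_combination :: "nat \<Rightarrow> (('v \<Rightarrow>\<^sub>0 nat) \<Rightarrow>\<^sub>0 's) \<Rightarrow> bool" where
  "congruent_combination d p \<longleftrightarrow> (\<exists>c. p \<approx> combination d c)"

lemma congruent_combination_add:
  assumes "congruent_combination d p" "congruent_combination d q"
  shows "congruent_combination d (p + q)"
proof -
  obtain c c' where "p \<approx> combination d c" "q \<approx> combination d c'"
    using assms by (auto simp: congruent_combination_def)
  then have "p + q \<approx> combination d c + combination d c'"
    by (rule generated_congruence.add)
  also have "combination d c + combination d c' = combination d (\<lambda>I. c I + c' I)"
    by (simp add: const_add distrib_right sum.distrib)
  finally show ?thesis
    by (auto simp: congruent_combination_def)
qed

lemma congruent_combination_0: "congruent_combination d 0"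
  unfolding congruent_combination_def
  by (rule exI [of _ "\<lambda>_. 0"]) (simp add: generated_congruence.refl)

lemma congruent_combination_sum:
  assumes "\<And>i. i \<in> A \<Longrightarrow> congruent_combination d (f i)"
  shows "congruent_combination d (\<Sum>i\<in>A. f i)"
  using assms
  by (induction A rule: infinite_finite_induct)
    (simp_all add: congruent_combination_0 congruent_combination_add)

lemma congruent_combination_const_mult:
  assumes "congruent_combination d p"
  shows "congruent_combination d (const a * p)"
proof -
  obtain c where "p \<approx> combination d c"
    using assms by (auto simp: congruent_combination_def)
  then have "const a * p \<approx> const a * combination d c"
    by (intro generated_congruence.mult generated_congruence.refl)
  also have "const a * combination d c = combination d (\<lambda>I. a * c I)"
    by (simp add: const_mult sum_distrib_left mult.assoc)
  finally show ?thesis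
    by (auto simp: congruent_combination_def)
qed

lemma congruent_combination_gen_mult:
  assumes "congruent_combination d p"
  shows "congruent_combination (Suc d) (gen v * p)"
proof -
  obtain c where "p \<approx> combination d c"
    using assms by (auto simp: congruent_combination_def)
  then have "gen v * p \<approx> gen v * combination d c"
    by (intro generated_congruence.mult generated_congruence.refl)
  then have "gen v * p \<approx> combination (d + 1) (\<lambda>J. \<Sum>i\<in>J. dual_basis scale n e i v * c (J - {i}))"
    using congruent_gen_mult_combination by (rule generated_congruence.trans)
  then show ?thesis
    unfolding congruent_combination_def Suc_eq_plus1
    by (rule exI [where x = "\<lambda>J. \<Sum>i\<in>J. dual_basis scale n e i v * c (J - {i})"])
qed

lemma congruent_combination_prod_gen:
  assumes "finite K"
  shows "congruent_combination (\<Sum>v\<in>K. f v) (\<Prod>v\<in>K. gen v ^ f v)"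
  using assms
proof (induction K)
  case empty
  have "{I. I \<subseteq> {1..n} \<and> card I = 0} = {{}}"
    by (auto simp: card_eq_0_iff dest: finite_index_set)
  then have "combination 0 (\<lambda>_. 1) = 1"
    by simp
  then show ?case
    unfolding congruent_combination_def
    by (intro exI [of _ "\<lambda>_. 1"]) (simp add: generated_congruence.refl)
next
  case (insert v K)
  have "congruent_combination (k + d) (gen v ^ k * p)" if "congruent_combination d p" for k d p
    using that by (induction k) (simp_all add: congruent_combination_gen_mult mult.assoc)
  then show ?case
    using insert by simp
qed

lemma homogeneous_congruent_combination:
  assumes "homogeneous d p"
  shows "congruent_combination d p"
proof -
  have "congruent_combination d (Poly_Mapping.single m (Poly_Mapping.lookup p m))"
    if "m \<in> Poly_Mapping.keys p" for m
  proof -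
    have "congruent_combination d (Poly_Mapping.single m 1)"
      using congruent_combination_prod_gen [of "Poly_Mapping.keys m" "Poly_Mapping.lookup m"]
        assms that by (simp add: monomial_eq_prod_gen homogeneous_def)
    then have "congruent_combination d (const (Poly_Mapping.lookup p m) * Poly_Mapping.single m 1)"
      by (rule congruent_combination_const_mult)
    then show ?thesis
      by (simp add: const_mult_single)
  qed
  then have "congruent_combination d
      (\<Sum>m\<in>Poly_Mapping.keys p. Poly_Mapping.single m (Poly_Mapping.lookup p m))"
    by (rule congruent_combination_sum)
  then show ?thesis
    by (rule back_subst [of "congruent_combination d"]) (rule poly_mapping_eq_sum_single [symmetric])
qed

text \<open>The linear polynomial of a vector, in indeterminates that are indexed by the basis. Substituting
  it for the generators makes all relations hold but \<open>e\<^sub>i\<^sup>2 \<sim> 0\<close>, which is true up to monomials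
  that are not squarefree.\<close>

definition coordinate_poly :: "'v \<Rightarrow> (nat \<Rightarrow>\<^sub>0 nat) \<Rightarrow>\<^sub>0 's" where
  "coordinate_poly v = (\<Sum>i\<in>{1..n}. const (dual_basis scale n e i v) * gen i)"

lemma coordinate_poly_basis:
  assumes "k \<in> {1..n}"
  shows "coordinate_poly (e k) = gen k"
proof -
  have "coordinate_poly (e k) = (\<Sum>i\<in>{1..n}. if i = k then gen i else 0)"
    unfolding coordinate_poly_def by (rule sum.cong) (auto simp: dual_basis_basis [OF assms])
  then show ?thesis
    using assms by simp
qed

lemma relation_agree_squarefree:
  assumes "grassmann_relation scale n e p q"
  shows "agree_squarefree (substitute coordinate_poly p) (substitute coordinate_poly q)"
  using assms
proof cases
  case (linear_add u v)
  then show ?thesis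
    by (simp add: substitute_add coordinate_poly_def dual_basis_add const_add distrib_right
        sum.distrib agree_squarefree_def)
next
  case (linear_scale a v)
  then show ?thesis
    by (simp add: substitute_mult coordinate_poly_def dual_basis_scale const_mult sum_distrib_left
        mult.assoc agree_squarefree_def)
next
  case (square i)
  then have "substitute coordinate_poly p = gen i ^ 2"
    by (simp add: power2_eq_square substitute_mult coordinate_poly_basis)
  also have "\<dots> = Poly_Mapping.single (Poly_Mapping.single i 2) 1"
    unfolding gen_def by (rule single_power)
  finally have "substitute coordinate_poly p = Poly_Mapping.single (Poly_Mapping.single i 2) 1" .
  moreover have "\<not> squarefree_monomial (Poly_Mapping.single i 2)"
    unfolding squarefree_monomial_def by (auto intro!: exI [of _ i])
  ultimately show ?thesis
    using square by (auto simp: agree_squarefree_def lookup_single when_def)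
qed

lemma congruent_agree_squarefree:
  assumes "p \<approx> q"
  shows "agree_squarefree (substitute coordinate_poly p) (substitute coordinate_poly q)"
  using assms
proof induction
  case (base p q)
  then show ?case
    by (rule relation_agree_squarefree)
next
  case (mult p q p' q')
  then show ?case
    by (simp add: substitute_mult agree_squarefree_mult)
qed (simp_all add: agree_squarefree_def substitute_add lookup_add)

text \<open>The squarefree monomial that the substitution makes of \<open>e\<^sub>I\<close>.\<close>

definition index_monomial :: "nat set \<Rightarrow> nat \<Rightarrow>\<^sub>0 nat" where
  "index_monomial I = (\<Sum>i\<in>I. Poly_Mapping.single i 1)"

lemma lookup_index_monomial:
  assumes "finite I"
  shows "Poly_Mapping.lookup (index_monomial I) i = (if i \<in> I then 1 else 0)"
  using assms by (simp add: index_monomial_def lookup_sum lookup_single when_def)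

lemma lookup_substitute_combination:
  assumes "I \<subseteq> {1..n}" "card I = d"
  shows "Poly_Mapping.lookup (substitute coordinate_poly (combination d c)) (index_monomial I) = c I"
proof -
  let ?D = "{I. I \<subseteq> {1..n} \<and> card I = d}"
  have substitute_term: "substitute coordinate_poly (const (c K) * (\<Prod>i\<in>K. gen (e i))) =
      Poly_Mapping.single (index_monomial K) (c K)" if "K \<in> ?D" for K
  proof -
    have "(\<Prod>i\<in>K. coordinate_poly (e i)) = (\<Prod>i\<in>K. gen i)"
      using that by (intro prod.cong) (auto simp: coordinate_poly_basis subset_eq)
    also have "\<dots> = Poly_Mapping.single (index_monomial K) 1"
      by (simp add: gen_def prod_single index_monomial_def)
    finally show ?thesis
      by (simp add: substitute_mult substitute_prod const_mult_single)
  qed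
  have injective: "index_monomial K = index_monomial I \<longleftrightarrow> K = I" if "K \<in> ?D" for K
  proof
    assume "index_monomial K = index_monomial I"
    moreover have "finite K" "finite I"
      using that assms(1) by (auto intro: finite_index_set)
    ultimately have "i \<in> K \<longleftrightarrow> i \<in> I" for i
      using lookup_index_monomial [of K i] lookup_index_monomial [of I i]
      by (auto split: if_splits)
    then show "K = I"
      by blast
  qed simp
  have "Poly_Mapping.lookup (substitute coordinate_poly (combination d c)) (index_monomial I) =
      (\<Sum>K\<in>?D. Poly_Mapping.lookup (Poly_Mapping.single (index_monomial K) (c K)) (index_monomial I))"
    unfolding substitute_sum lookup_sum by (rule sum.cong) (simp_all add: substitute_term)
  also have "\<dots> = (\<Sum>K\<in>?D. if K = I then c K else 0)"
    by (rule sum.cong) (auto simp: lookup_single when_def injective)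
  also have "\<dots> = c I"
    using assms by simp
  finally show ?thesis .
qed

lemma combination_coeffs_unique:
  assumes "combination d c \<approx> combination d c'" "I \<subseteq> {1..n}" "card I = d"
  shows "c I = c' I"
proof -
  have "squarefree_monomial (index_monomial I)"
    using finite_index_set [OF assms(2)] by (simp add: squarefree_monomial_def lookup_index_monomial)
  then show ?thesis
    using congruent_agree_squarefree [OF assms(1)]
    by (auto simp: agree_squarefree_def lookup_substitute_combination [OF assms(2,3)] dest!: spec)
qed

lemma class_combination_eq_iff:
  "grassmann_class scale n e (combination d c) = grassmann_class scale n e (combination d c') \<longleftrightarrow>
    (\<forall>I. I \<subseteq> {1..n} \<and> card I = d \<longrightarrow> c I = c' I)"
proof
  assume "\<forall>I. I \<subseteq> {1..n} \<and> card I = d \<longrightarrow> c I = c' I"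
  then have "combination d c = combination d c'"
    by (intro sum.cong) auto
  then show "grassmann_class scale n e (combination d c) = grassmann_class scale n e (combination d c')"
    by simp
next
  assume "grassmann_class scale n e (combination d c) = grassmann_class scale n e (combination d c')"
  then show "\<forall>I. I \<subseteq> {1..n} \<and> card I = d \<longrightarrow> c I = c' I"
    unfolding class_eq_iff using combination_coeffs_unique by blast
qed

lemma grassmann_degree_eq_combination:
  assumes "W \<in> grassmann_degree scale n e d"
  shows "W = grassmann_class scale n e (combination d (grassmann_coeff scale n e d W))"
proof -
  obtain p q where W: "W = grassmann_class scale n e q" "p \<in> W" "homogeneous d p"
    using assms
    by (auto simp: grassmann_degree_def grassmann_algebra_def quotient_def grassmann_class_def)
  obtain c where "p \<approx> combination d c"
    using homogeneous_congruent_combination [OF W(3)] by (auto simp: congruent_combination_def)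
  with W have c: "W = grassmann_class scale n e (combination d c)"
    by (auto simp: mem_class_iff class_eq_iff intro: generated_congruence.trans)
  \<comment> \<open>The description in the definition of the coefficients is unique only for functions that vanish
    outside the index sets.\<close>
  let ?c = "\<lambda>I. if I \<subseteq> {1..n} \<and> card I = d then c I else 0"
  have "(THE c'. (\<forall>I. \<not> (I \<subseteq> {1..n} \<and> card I = d) \<longrightarrow> c' I = 0)
      \<and> W = grassmann_combination scale n e d c') = ?c"
  proof (rule the_equality)
    show "(\<forall>I. \<not> (I \<subseteq> {1..n} \<and> card I = d) \<longrightarrow> ?c I = 0) \<and> W = grassmann_combination scale n e d ?c"
      by (auto simp: c grassmann_combination_def class_combination_eq_iff)
  next
    fix c'
    assume "(\<forall>I. \<not> (I \<subseteq> {1..n} \<and> card I = d) \<longrightarrow> c' I = 0) \<and> W = grassmann_combination scale n e d c'"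
    then show "c' = ?c"
      by (auto simp: c grassmann_combination_def class_combination_eq_iff fun_eq_iff)
  qed
  then have coeff: "grassmann_coeff scale n e d W = ?c"
    by (simp add: grassmann_coeff_def fun_eq_iff)
  note c
  also have "grassmann_class scale n e (combination d c) = grassmann_class scale n e (combination d ?c)"
    by (simp add: class_combination_eq_iff)
  finally show ?thesis
    unfolding coeff .
qed

section \<open>Linear spaces as kernels\<close>

lemma tropical_linear_space_eq_kernel:
  assumes "W \<in> grassmann_degree scale n e d"
  shows "tropical_linear_space scale n e d W = tropical_kernel scale n e (wedge_map scale n e W)"
proof -
  let ?c = "grassmann_coeff scale n e d W"
  let ?x = "dual_basis scale n e"
  \<comment> \<open>The sets \<open>K\<close> that occur are \<open>{1..n}\<close> and \<open>{1..n} - {j}\<close>: a partial sum over \<open>K\<close> has the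
    coordinates of \<open>v\<close> on \<open>K\<close> and zeros elsewhere.\<close>
  have kernel_side: "wedge_map scale n e W (\<Sum>k\<in>K. scale (?x k v) (e k)) =
      grassmann_class scale n e (combination (d + 1) (\<lambda>J. \<Sum>i\<in>J \<inter> K. ?x i v * ?c (J - {i})))"
    if "K \<subseteq> {1..n}" for K v
  proof -
    let ?u = "\<Sum>k\<in>K. scale (?x k v) (e k)"
    have "wedge_map scale n e W ?u = grassmann_class scale n e (gen ?u * combination d ?c)"
      unfolding wedge_map_def
      by (subst grassmann_degree_eq_combination [OF assms]) (rule wedge_class)
    also have "\<dots> = grassmann_class scale n e
        (combination (d + 1) (\<lambda>J. \<Sum>i\<in>J. ?x i ?u * ?c (J - {i})))"
      unfolding class_eq_iff by (rule congruent_gen_mult_combination)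
    also have "\<dots> = grassmann_class scale n e
        (combination (d + 1) (\<lambda>J. \<Sum>i\<in>J \<inter> K. ?x i v * ?c (J - {i})))"
      unfolding class_combination_eq_iff
    proof (intro allI impI)
      fix J
      assume "J \<subseteq> {1..n} \<and> card J = d + 1"
      then have "finite J"
        by (auto intro: finite_index_set)
      then show "(\<Sum>i\<in>J. ?x i ?u * ?c (J - {i})) = (\<Sum>i\<in>J \<inter> K. ?x i v * ?c (J - {i}))"
        by (intro sum.mono_neutral_cong_right) (auto simp: dual_basis_partial_sum [OF that])
    qed
    finally show ?thesis .
  qed
  have hyperplane_side: "(\<Sum>i\<in>K. (\<Sum>k\<in>J. ?c (J - {k}) * ?x k (e i)) * ?x i v) =
      (\<Sum>i\<in>J \<inter> K. ?x i v * ?c (J - {i}))"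
    if "J \<subseteq> {1..n}" "K \<subseteq> {1..n}" for J K v
  proof -
    have "finite J" "finite K"
      using that by (auto intro: finite_index_set)
    have "(\<Sum>k\<in>J. ?c (J - {k}) * ?x k (e i)) = (if i \<in> J then ?c (J - {i}) else 0)"
      if "i \<in> K" for i
    proof -
      have "i \<in> {1..n}"
        using that \<open>K \<subseteq> {1..n}\<close> by blast
      then have "(\<Sum>k\<in>J. ?c (J - {k}) * ?x k (e i)) = (\<Sum>k\<in>J. if k = i then ?c (J - {k}) else 0)"
        by (intro sum.cong) (simp_all add: dual_basis_basis)
      then show ?thesis
        using \<open>finite J\<close> by simp
    qed
    then show ?thesis
      using \<open>finite K\<close> by (intro sum.mono_neutral_cong_right) (auto simp: mult.commute)
  qed
  show ?thesis
  proof (rule set_eqI)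
    fix v
    let ?P = "\<lambda>J j. (\<Sum>i\<in>J \<inter> {1..n}. ?x i v * ?c (J - {i})) =
        (\<Sum>i\<in>J \<inter> ({1..n} - {j}). ?x i v * ?c (J - {i}))"
    have "v \<in> tropical_linear_space scale n e d W \<longleftrightarrow>
        (\<forall>J. J \<subseteq> {1..n} \<and> card J = d + 1 \<longrightarrow> (\<forall>j\<in>{1..n}. ?P J j))"
      unfolding tropical_linear_space_def tropical_hyperplane_def INT_iff mem_Collect_eq Ball_def
      by (simp only: hyperplane_side subset_refl Diff_subset cong: imp_cong)
    also have "\<dots> \<longleftrightarrow> (\<forall>j\<in>{1..n}. \<forall>J. J \<subseteq> {1..n} \<and> card J = d + 1 \<longrightarrow> ?P J j)"
      by blast
    also have "\<dots> \<longleftrightarrow> v \<in> tropical_kernel scale n e (wedge_map scale n e W)"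
      by (simp only: tropical_kernel_def mem_Collect_eq kernel_side [OF subset_refl]
          kernel_side [OF Diff_subset] class_combination_eq_iff)
    finally show "v \<in> tropical_linear_space scale n e d W \<longleftrightarrow>
        v \<in> tropical_kernel scale n e (wedge_map scale n e W)" .
  qed
qed

end

theorem proposition4p2p1:
  fixes scale :: "'s::idempotent_semifield \<Rightarrow> 'v::comm_monoid_add \<Rightarrow> 'v"
    and n d :: nat
    and e :: "nat \<Rightarrow> 'v"
    and w :: "(('v \<Rightarrow>\<^sub>0 nat) \<Rightarrow>\<^sub>0 's) set"
  assumes "free_semimodule scale n e"
    and "tropical_pluecker_vector scale n e d w"
  shows "tropical_linear_space scale n e d w = tropical_kernel scale n e (wedge_map scale n e w)"
proof -
  have "w \<in> grassmann_degree scale n e d"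
    using assms(2) by (simp add: tropical_pluecker_vector_def)
  with assms(1) show ?thesis
    by (rule free_semimodule.tropical_linear_space_eq_kernel)
qed

end
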